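(* Let $k \geq 3$ and $s = R(k)-1$, and let $p=p(n)$ satisfy $n^{-s} \ll p \ll n^{2-s - 1/m_2(K_k)}$ (i.e. $p n^{s}\to\infty$ and $p\, n^{s-2+1/m_2(K_k)}\to 0$). Let $\mathcal{H} = \mathcal{H}_s(n,p)$. Then there is a function $\varepsilon(n)\to 0$ such that, with probability tending to $1$ as $n\to\infty$, there exists a subhypergraph $\mathcal{H}_0 \subseteq \mathcal{H}$ with $e(\mathcal{H}_0)\geq(1-\varepsilon(n))e(\mathcal{H})$ such that $G[\mathcal{H}_0]\nrightarrow K_k$.
   Context: $R(k)$ is the minimum $n$ such that every red-blue colouring of the edges of $K_n$ contains a monochromatic $K_k$. For a graph $G$, $G\nrightarrow K_k$ means there is a red-blue colouring of the edges of $G$ with no monochromatic copy of $K_k$. The maximum $2$-density of a graph $F$ is $m_2(F)=\max\{\frac{e(J)-1}{v(J)-2} : J\subseteq F,\ v(J)\geq 3\}$. The random $s$-uniform hypergraph $\mathcal{H}_s(n,p)$ has $n$ vertices and contains each $s$-element subset of vertices as a hyperedge independently with probability $p$; $e(\mathcal{H})$ is its number of hyperedges. The primal graph $G[\mathcal{H}]$ has vertex set $V(\mathcal{H})$ and edges all pairs of vertices lying together in some hyperedge of $\mathcal{H}$. *)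

theory Defs
  imports "HOL-Library.Ramsey" "HOL-Probability.Probability"
begin

text \<open>
  A hypergraph is a pair of a vertex set and a set of hyperedges; a graph is the case in which
  every edge has two elements.
\<close>

type_synonym 'a hypergraph = "'a set \<times> 'a set set"

abbreviation verts :: "'a hypergraph \<Rightarrow> 'a set" where
  "verts \<equiv> fst"

abbreviation edges :: "'a hypergraph \<Rightarrow> 'a set set" where
  "edges \<equiv> snd"

definition subhypergraph :: "'a hypergraph \<Rightarrow> 'a hypergraph \<Rightarrow> bool" where
  "subhypergraph J F \<longleftrightarrow>
     verts J \<subseteq> verts F \<and> edges J \<subseteq> edges F \<and> (\<forall>e\<in>edges J. e \<subseteq> verts J)"

definition complete_graph_on :: "'a set \<Rightarrow> 'a hypergraph" where
  "complete_graph_on V = (V, [V]\<^bsup>2\<^esup>)"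

definition mono_clique :: "'a hypergraph \<Rightarrow> ('a set \<Rightarrow> bool) \<Rightarrow> nat \<Rightarrow> bool" where
  "mono_clique G c k \<longleftrightarrow>
     (\<exists>S \<in> [verts G]\<^bsup>k\<^esup>. subhypergraph (complete_graph_on S) G \<and>
        (\<exists>col. \<forall>e \<in> edges (complete_graph_on S). c e = col))"

text \<open>
  The two truth values are the two colours. A colouring is a function on all sets of vertices,
  but only its values on the edges of \<open>G\<close> matter.
\<close>

definition not_arrows :: "'a hypergraph \<Rightarrow> nat \<Rightarrow> bool" where
  "not_arrows G k \<longleftrightarrow> (\<exists>c :: 'a set \<Rightarrow> bool. \<not> mono_clique G c k)"

definition ramsey_number :: "nat \<Rightarrow> nat" where
  "ramsey_number k = (LEAST n. \<forall>c. mono_clique (complete_graph_on {..<n}) c k)"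

text \<open>The minimum is attained, so that \<open>LEAST\<close> is not underspecified.\<close>

lemma ramsey_number_attained:
  "mono_clique (complete_graph_on {..<ramsey_number k}) c k"
proof -
  obtain N :: nat where N: "partn_lst {..<N} [k, k] 2"
    using ramsey_full by blast
  have "mono_clique (complete_graph_on {..<N}) c k" for c
  proof -
    define f where "f = (\<lambda>e. if c e then 0 else 1 :: nat)"
    have "f \<in> [{..<N}]\<^bsup>2\<^esup> \<rightarrow> {..<length [k, k]}"
      by (auto simp: f_def)
    then obtain i where i: "i < length [k, k]" "monochromatic {..<N} ([k, k] ! i) 2 f i"
      using N unfolding partn_lst_def by blast
    then have "[k, k] ! i = k"
      by (cases i) simp_all
    then obtain S where S: "S \<in> [{..<N}]\<^bsup>k\<^esup>" "f ` [S]\<^bsup>2\<^esup> \<subseteq> {i}"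
      using i(2) unfolding monochromatic_def by metis
    have "c e = (i = 0)" if "e \<in> [S]\<^bsup>2\<^esup>" for e
    proof -
      have "f e = i"
        using S(2) that by blast
      then show ?thesis
        by (auto simp: f_def split: if_splits)
    qed
    moreover have "subhypergraph (complete_graph_on S) (complete_graph_on {..<N})"
      using S(1) by (auto simp: subhypergraph_def complete_graph_on_def nsets_def)
    moreover have "S \<in> [verts (complete_graph_on {..<N})]\<^bsup>k\<^esup>"
      using S(1) by (simp add: complete_graph_on_def)
    ultimately show ?thesis
      unfolding mono_clique_def by (metis complete_graph_on_def snd_conv)
  qed
  then have "\<forall>c. mono_clique (complete_graph_on {..<ramsey_number k}) c k"
    unfolding ramsey_number_def by (rule LeastI[of _ N, OF allI])
  then show ?thesis by (rule spec)
qed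

text \<open>Meaningful for finite graphs with at least three vertices.\<close>

definition max_2_density :: "'a hypergraph \<Rightarrow> real" where
  "max_2_density F =
     Max {(real (card (edges J)) - 1) / (real (card (verts J)) - 2) | J.
            subhypergraph J F \<and> card (verts J) \<ge> 3}"

definition random_hypergraph :: "nat \<Rightarrow> nat \<Rightarrow> real \<Rightarrow> nat hypergraph pmf" where
  "random_hypergraph s n p =
     map_pmf (\<lambda>X. ({..<n}, {e \<in> [{..<n}]\<^bsup>s\<^esup>. X e}))
       (Pi_pmf ([{..<n}]\<^bsup>s\<^esup>) False (\<lambda>_. bernoulli_pmf p))"

definition primal_graph :: "'a hypergraph \<Rightarrow> 'a hypergraph" where
  "primal_graph H =
     (verts H, {{u, v} | u v. u \<noteq> v \<and> (\<exists>h \<in> edges H. u \<in> h \<and> v \<in> h)})"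

end

theory Submission
  imports Defs
begin

text \<open>
  Put \<open>x = 1 / m\<^sub>2(K\<^sub>k) = 2 / (k + 1)\<close> and \<open>q = p n\<^bsup>s - 2 + x\<^esup> \<longrightarrow> 0\<close>. If any two hyperedges share at
  most one vertex and every \<open>K\<^sub>k\<close> of the primal graph lies inside a single hyperedge, then giving each
  hyperedge its own copy of a Ramsey colouring of \<open>K\<^sub>s\<close> avoids monochromatic copies of \<open>K\<^sub>k\<close>. Failure of
  these conditions is witnessed by a family \<open>F\<close> of at least two hyperedges covering all pairs of
  a set \<open>S\<close> of \<open>2\<close> or \<open>k\<close> vertices, and one hyperedge of every such family is deleted.

  A hyperedge meeting \<open>S\<close> in \<open>a\<close> vertices costs \<open>p n\<^bsup>s - a\<^esup> = q n\<^bsup>-(a - 2 + x)\<^esup>\<close>. For \<open>2 \<le> a \<le> k\<close> we have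
  \<open>a - 2 + x \<ge> x (a choose 2)\<close>, with equality at \<open>a = 2\<close> and \<open>a = k\<close>; since \<open>F\<close> covers the pairs of
  \<open>S\<close>, the exponents sum to at least \<open>|S| - 2 + x\<close>. So the expected number of such families is at
  most of order \<open>n\<^bsup>|S|\<^esup> q\<^sup>2 n\<^bsup>-(|S| - 2 + x)\<^esup> = q \<cdot> p n\<^sup>s\<close>, which is \<open>o(e(H))\<close> by Markov's inequality.
\<close>

section \<open>The 2-density of complete graphs and colourings below the Ramsey number\<close>

lemma real_choose_two: "real (n choose 2) = real n * (real n - 1) / 2"
proof -
  have "even (n * (n - 1))" by (cases "even n") auto
  then show ?thesis
    by (cases n) (auto simp: choose_two real_of_nat_div algebra_simps)
qed

text \<open>On \<open>v\<close> vertices the best subgraph is complete, with ratio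
  \<open>(v + 1) / 2\<close>. This increases with \<open>v\<close>, so the maximum is attained by
  the whole graph.\<close>

lemma max_2_density_complete:
  assumes "k \<ge> 3"
  shows "max_2_density (complete_graph_on {..<k}) = (real k + 1) / 2"
proof -
  define D where "D = (\<lambda>J :: nat hypergraph. (real (card (edges J)) - 1) / (real (card (verts J)) - 2))"
  define \<J> where "\<J> = {J. subhypergraph J (complete_graph_on {..<k}) \<and> card (verts J) \<ge> 3}"
  have clique: "(real (v choose 2) - 1) / (real v - 2) = (real v + 1) / 2" if "v \<ge> 3" for v
    using that by (simp add: real_choose_two field_simps) 
  have "\<J> \<subseteq> Pow {..<k} \<times> Pow ([{..<k}]\<^bsup>2\<^esup>)"
    by (auto simp: \<J>_def subhypergraph_def complete_graph_on_def)
  then have "finite \<J>"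
    by (rule finite_subset) (simp add: finite_imp_finite_nsets)
  moreover have "D J \<le> (real k + 1) / 2" if "J \<in> \<J>" for J
  proof -
    have J: "verts J \<subseteq> {..<k}" "edges J \<subseteq> [verts J]\<^bsup>2\<^esup>" "card (verts J) \<ge> 3"
      using that by (auto simp: \<J>_def subhypergraph_def complete_graph_on_def nsets_def)
    have fin: "finite (verts J)"
      using J(1) finite_subset by blast
    have "card (edges J) \<le> card (verts J) choose 2"
      using card_mono[OF finite_imp_finite_nsets[OF fin] J(2)] by simp
    then have "D J \<le> (real (card (verts J) choose 2) - 1) / (real (card (verts J)) - 2)"
      using J(3) unfolding D_def by (intro divide_right_mono) auto
    also have "\<dots> = (real (card (verts J)) + 1) / 2"
      using clique J(3) by blast
    also have "card (verts J) \<le> k"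
      using card_mono[OF _ J(1)] by simp
    finally show ?thesis by simp
  qed
  moreover have "(real k + 1) / 2 \<in> D ` \<J>"
  proof
    show "complete_graph_on {..<k} \<in> \<J>"
      using assms by (auto simp: \<J>_def subhypergraph_def complete_graph_on_def nsets_def)
    show "(real k + 1) / 2 = D (complete_graph_on {..<k})"
      using clique[OF assms] by (simp add: D_def complete_graph_on_def)
  qed
  ultimately have "Max (D ` \<J>) = (real k + 1) / 2"
    by (intro Max_eqI) auto
  moreover have "D ` \<J> = {(real (card (edges J)) - 1) / (real (card (verts J)) - 2) | J.
      subhypergraph J (complete_graph_on {..<k}) \<and> card (verts J) \<ge> 3}"
    unfolding D_def \<J>_def by blast
  ultimately show ?thesis
    by (simp add: max_2_density_def)
qed

lemma ramsey_number_ge: "k \<le> ramsey_number k"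
proof -
  obtain S where "S \<in> [{..<ramsey_number k}]\<^bsup>k\<^esup>"
    using ramsey_number_attained[of k] by (auto simp: mono_clique_def complete_graph_on_def)
  then have "k = card S" "S \<subseteq> {..<ramsey_number k}"
    by (auto simp: nsets_def)
  then show ?thesis
    using card_mono[of "{..<ramsey_number k}" S] by simp
qed

text \<open>Holds by minimality of the Ramsey number. It is phrased through pairs and
  \<open>k\<close>-subsets of \<open>{..<s}\<close> so that the colouring can be transported to a
  hyperedge along a bijection.\<close>

lemma ramsey_colouring_below:
  assumes "s < ramsey_number k"
  shows "\<exists>c. \<forall>S \<in> [{..<s}]\<^bsup>k\<^esup>. \<forall>col. \<exists>e\<in>[S]\<^bsup>2\<^esup>. c e \<noteq> (col :: bool)"
proof -
  obtain c where c: "\<not> mono_clique (complete_graph_on {..<s}) c k"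
    using not_less_Least assms unfolding ramsey_number_def by blast
  have "subhypergraph (complete_graph_on S) (complete_graph_on {..<s})" if "S \<in> [{..<s}]\<^bsup>k\<^esup>" for S
    using that by (auto simp: subhypergraph_def complete_graph_on_def nsets_def)
  then have "\<forall>S \<in> [{..<s}]\<^bsup>k\<^esup>. \<forall>col. \<exists>e\<in>[S]\<^bsup>2\<^esup>. c e \<noteq> (col :: bool)"
    using c by (simp add: mono_clique_def complete_graph_on_def)
  then show ?thesis by (intro exI[of _ c])
qed

section \<open>Obstructions to colouring the primal graph, and their removal\<close>

text \<open>\<open>card S = 2\<close> records two hyperedges sharing a pair,
  \<open>card S = k\<close> a clique not inside a single hyperedge. Demanding that each member of
  \<open>F\<close> meets \<open>S\<close> at least twice keeps the intersection sizes in the range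
  where the exponent inequality holds; \<open>2 \<le> card F\<close> supplies the factor
  \<open>q^2\<close>.\<close>

definition obstruction :: "nat \<Rightarrow> 'a set \<Rightarrow> 'a set set \<Rightarrow> bool" where
  "obstruction k S F \<longleftrightarrow> card S \<in> {2, k} \<and> 2 \<le> card F \<and>
     (\<forall>h\<in>F. 2 \<le> card (h \<inter> S)) \<and> [S]\<^bsup>2\<^esup> \<subseteq> (\<Union>h\<in>F. [h]\<^bsup>2\<^esup>)"

text \<open>Excluding obstructions with \<open>card S = 2\<close> makes each pair lie in at most one
  hyperedge, so colouring the hyperedges separately is consistent. Excluding those with
  \<open>card S = k\<close> confines every \<open>k\<close>-clique to one hyperedge.\<close>

lemma no_obstruction_imp_not_arrows:
  assumes k: "k \<ge> 3" and s: "s < ramsey_number k"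
    and V: "finite V" and E: "E \<subseteq> [V]\<^bsup>s\<^esup>"
    and free: "\<And>S F. S \<subseteq> V \<Longrightarrow> F \<subseteq> E \<Longrightarrow> \<not> obstruction k S F"
  shows "not_arrows (primal_graph (V, E)) k"
proof -
  have finE: "finite E"
    using finite_subset[OF E finite_imp_finite_nsets[OF V]] .
  have edge: "h \<subseteq> V" "finite h" "card h = s" if "h \<in> E" for h
    using E that by (auto simp: nsets_def)
  have linear: "h = h'" if h: "h \<in> E" "h' \<in> E" and e: "e \<in> [h]\<^bsup>2\<^esup>" "e \<in> [h']\<^bsup>2\<^esup>" for h h' e
  proof (rule ccontr)
    assume ne: "h \<noteq> h'"
    have c: "card e = 2" "e \<subseteq> h" "e \<subseteq> h'" "finite e"
      using e by (auto simp: nsets_def)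
    then have "h \<inter> e = e" "h' \<inter> e = e" by auto
    moreover have "[e]\<^bsup>2\<^esup> \<subseteq> [h]\<^bsup>2\<^esup>"
      using c(2) by (rule nsets_mono)
    ultimately have "obstruction k e {h, h'}"
      using ne c by (auto simp: obstruction_def)
    moreover have "e \<subseteq> V"
      using edge(1)[OF h(1)] c(2) by blast
    ultimately show False
      using free h by auto
  qed
  obtain c0 where c0: "\<forall>S \<in> [{..<s}]\<^bsup>k\<^esup>. \<forall>col. \<exists>e\<in>[S]\<^bsup>2\<^esup>. c0 e \<noteq> (col :: bool)"
    using ramsey_colouring_below[OF s] by blast
  have "\<exists>g. bij_betw g h {..<s}" if "h \<in> E" for h
    using edge[OF that] ex_bij_betw_finite_nat[of h] by (auto simp: atLeast0LessThan)
  then obtain g where g: "\<And>h. h \<in> E \<Longrightarrow> bij_betw (g h) h {..<s}"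
    by metis
  \<comment> \<open>The choice is unambiguous on pairs inside hyperedges, by \<open>linear\<close>;
    its value on other sets is irrelevant.\<close>
  define line where "line = (\<lambda>e. SOME h. h \<in> E \<and> e \<in> [h]\<^bsup>2\<^esup>)"
  have line: "line e = h" if "h \<in> E" "e \<in> [h]\<^bsup>2\<^esup>" for e h
    using someI[of "\<lambda>h. h \<in> E \<and> e \<in> [h]\<^bsup>2\<^esup>" h] that linear unfolding line_def by blast
  define c where "c = (\<lambda>e. c0 (g (line e) ` e))"
  have "\<not> mono_clique (primal_graph (V, E)) c k"
  proof
    assume "mono_clique (primal_graph (V, E)) c k"
    then obtain S col where S: "S \<subseteq> V" "finite S" "card S = k"
        and cov: "[S]\<^bsup>2\<^esup> \<subseteq> edges (primal_graph (V, E))"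
        and col: "\<And>e. e \<in> [S]\<^bsup>2\<^esup> \<Longrightarrow> c e = col"
      by (auto simp: mono_clique_def subhypergraph_def complete_graph_on_def primal_graph_def nsets_def)
    \<comment> \<open>All hyperedges meeting \<open>S\<close> in a pair are taken. This family
      satisfies every clause of an obstruction except possibly \<open>2 \<le> card F\<close>, so it
      must consist of a single hyperedge, which then contains \<open>S\<close>.\<close>
    define F where "F = {h \<in> E. 2 \<le> card (h \<inter> S)}"
    have covF: "\<exists>h\<in>F. e \<in> [h]\<^bsup>2\<^esup>" if e: "e \<in> [S]\<^bsup>2\<^esup>" for e
    proof -
      obtain u v h where uv: "e = {u, v}" "u \<noteq> v" "h \<in> E" "u \<in> h" "v \<in> h"
        using cov e by (auto simp: primal_graph_def)
      then have "e \<subseteq> h \<inter> S" "card e = 2"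
        using e by (auto simp: nsets_def)
      then have "2 \<le> card (h \<inter> S)"
        using card_mono[of "h \<inter> S" e] S(2) by simp
      then show ?thesis
        using uv by (auto simp: F_def)
    qed
    have "\<not> obstruction k S F"
      by (rule free) (use S in \<open>auto simp: F_def\<close>)
    then have "card F \<le> 1"
      using covF S by (auto simp: obstruction_def F_def not_le)
    moreover have "finite F"
      using finE by (simp add: F_def)
    moreover obtain a b where ab: "a \<in> S" "b \<in> S" "a \<noteq> b"
      using k S(3) card_le_Suc0_iff_eq[OF S(2)] by force
    then have "F \<noteq> {}"
      using covF[of "{a, b}"] by auto
    ultimately obtain h where F: "F = {h}"
      by (metis card_1_singletonE card_0_eq le_antisym less_one not_less)
    then have h: "h \<in> E"
      by (auto simp: F_def)
    have sub: "S \<subseteq> h"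
    proof
      fix u assume u: "u \<in> S"
      obtain v where "v \<in> S" "v \<noteq> u"
        using ab by metis
      then show "u \<in> h"
        using covF[of "{u, v}"] F u by auto
    qed
    \<comment> \<open>The clique is carried into \<open>{..<s}\<close>, where \<open>c0\<close>
      gives some pair a colour other than \<open>col\<close>; pulling that pair back to
      \<open>S\<close> yields the contradiction.\<close>
    have inj: "inj_on (g h) S"
      using g[OF h] sub by (meson bij_betw_def inj_on_subset)
    have "g h ` S \<subseteq> {..<s}"
      using g[OF h] sub by (auto simp: bij_betw_def)
    moreover have "card (g h ` S) = k"
      using inj S(3) by (simp add: card_image)
    ultimately have "g h ` S \<in> [{..<s}]\<^bsup>k\<^esup>"
      using S(2) by (simp add: nsets_def)
    then obtain e where e: "e \<in> [g h ` S]\<^bsup>2\<^esup>" "c0 e \<noteq> col"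
      using c0 by blast
    then obtain a b where ab: "e = g h ` {a, b}" "a \<in> S" "b \<in> S" "a \<noteq> b"
      by (auto elim!: nsets2_E)
    then have "{a, b} \<in> [S]\<^bsup>2\<^esup>" "{a, b} \<in> [h]\<^bsup>2\<^esup>"
      using sub by auto
    then show False
      using col[of "{a, b}"] line[OF h, of "{a, b}"] ab(1) e(2) by (simp add: c_def)
  qed
  then show ?thesis
    by (auto simp: not_arrows_def)
qed

text \<open>Deleting one chosen hyperedge \<open>r F\<close> from each obstructing family
  \<open>F\<close> destroys them all, since a surviving family would still contain its own
  \<open>r F\<close>. At most one deletion is charged to each family, however many sets
  \<open>S\<close> it obstructs.\<close>

lemma removal_not_arrows:
  assumes k: "k \<ge> 3" and s: "s < ramsey_number k"
    and V: "finite V" and E: "E \<subseteq> [V]\<^bsup>s\<^esup>"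
  shows "\<exists>H0. subhypergraph H0 (V, E) \<and> not_arrows (primal_graph H0) k \<and>
    card E \<le> card (edges H0) + card {F. F \<subseteq> E \<and> (\<exists>S\<subseteq>V. obstruction k S F)}"
proof -
  define \<B> where "\<B> = {F. F \<subseteq> E \<and> (\<exists>S\<subseteq>V. obstruction k S F)}"
  have finE: "finite E"
    using finite_subset[OF E finite_imp_finite_nsets[OF V]] .
  have fin\<B>: "finite \<B>"
    by (rule finite_subset[of _ "Pow E"]) (use finE in \<open>auto simp: \<B>_def\<close>)
  have "F \<noteq> {}" if "F \<in> \<B>" for F
    using that by (auto simp: \<B>_def obstruction_def)
  then obtain r where r: "\<And>F. F \<in> \<B> \<Longrightarrow> r F \<in> F"
    by (metis ex_in_conv)
  define E0 where "E0 = E - r ` \<B>"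
  have "not_arrows (primal_graph (V, E0)) k"
  proof (rule no_obstruction_imp_not_arrows[OF k s V])
    show "E0 \<subseteq> [V]\<^bsup>s\<^esup>"
      using E by (auto simp: E0_def)
    fix S F assume SF: "S \<subseteq> V" "F \<subseteq> E0"
    show "\<not> obstruction k S F"
    proof
      assume "obstruction k S F"
      then have "F \<in> \<B>"
        using SF by (auto simp: \<B>_def E0_def)
      then show False
        using r[of F] SF(2) by (auto simp: E0_def)
    qed
  qed
  moreover have "subhypergraph (V, E0) (V, E)"
    using E by (auto simp: subhypergraph_def E0_def nsets_def)
  moreover have "card E \<le> card E0 + card \<B>"
    using diff_card_le_card_Diff[of "r ` \<B>" E] card_image_le[OF fin\<B>, of r] fin\<B>
    by (simp add: E0_def)
  ultimately show ?thesis
    unfolding \<B>_def[symmetric] by (intro exI[of _ "(V, E0)"]) simp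
qed

section \<open>Weighted count of obstructions\<close>

text \<open>Covering the pairs of \<open>S\<close> gives \<open>card S choose 2\<close> at most the
  sum of the \<open>card (h \<inter> S) choose 2\<close>. Multiplying by \<open>x\<close> turns the
  left side into the linear expression exactly and each right-hand term into at most the linear one,
  because a convex quadratic lies below its chord between 2 and \<open>k\<close>.\<close>

lemma obstruction_exponent:
  assumes F: "finite F" and obs: "obstruction k S F" and k: "k \<ge> 2"
  defines "x \<equiv> 2 / (real k + 1)"
  shows "real (card S) - 2 + x \<le> (\<Sum>h\<in>F. real (card (h \<inter> S)) - 2 + x)"
proof -
  have S: "card S \<in> {2, k}" and two: "\<And>h. h \<in> F \<Longrightarrow> 2 \<le> card (h \<inter> S)"
    and cov: "[S]\<^bsup>2\<^esup> \<subseteq> (\<Union>h\<in>F. [h]\<^bsup>2\<^esup>)"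
    using obs by (auto simp: obstruction_def)
  have finS: "finite S"
    using S k by (intro card_ge_0_finite) auto
  \<comment> \<open>Both admissible sizes, 2 and \<open>k\<close>, are endpoints of the chord, so
    equality holds.\<close>
  have "real (card S) - 2 + x = x * real (card S choose 2)"
    using S by (auto simp: real_choose_two x_def field_simps)
  also have "[S]\<^bsup>2\<^esup> \<subseteq> (\<Union>h\<in>F. [h \<inter> S]\<^bsup>2\<^esup>)"
  proof
    fix e assume e: "e \<in> [S]\<^bsup>2\<^esup>"
    then obtain h where "h \<in> F" "e \<in> [h]\<^bsup>2\<^esup>"
      using cov by blast
    then show "e \<in> (\<Union>h\<in>F. [h \<inter> S]\<^bsup>2\<^esup>)"
      using e by (auto simp: nsets_def)
  qed
  then have "card S choose 2 \<le> card (\<Union>h\<in>F. [h \<inter> S]\<^bsup>2\<^esup>)"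
    using card_mono[of "\<Union>h\<in>F. [h \<inter> S]\<^bsup>2\<^esup>" "[S]\<^bsup>2\<^esup>"] F finS by (simp add: finite_imp_finite_nsets)
  also have "\<dots> \<le> (\<Sum>h\<in>F. card ([h \<inter> S]\<^bsup>2\<^esup>))"
    by (rule card_UN_le[OF F])
  finally have "real (card S) - 2 + x \<le> x * real (\<Sum>h\<in>F. card (h \<inter> S) choose 2)"
    by (simp add: x_def divide_right_mono)
  also have "\<dots> = (\<Sum>h\<in>F. x * real (card (h \<inter> S) choose 2))"
    by (simp add: sum_distrib_left)
  also have "\<dots> \<le> (\<Sum>h\<in>F. real (card (h \<inter> S)) - 2 + x)"
  proof (rule sum_mono)
    fix h assume h: "h \<in> F"
    define a where "a = real (card (h \<inter> S))"
    have "card (h \<inter> S) \<le> card S"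
      using finS by (intro card_mono) auto
    then have "2 \<le> a" "a \<le> real k"
      using two[OF h] S k by (auto simp: a_def)
    moreover define y where "y = 1 / (real k + 1)"
    moreover have "x = 2 * y"
      by (simp add: x_def y_def)
    \<comment> \<open>This product is precisely the gap between chord and parabola, as the identity
      below shows using \<open>y * (k + 1) = 1\<close>.\<close>
    ultimately have "0 \<le> (a - 2) * (real k - a) * y"
      by simp
    also have "y * (real k + 1) = 1"
      by (simp add: y_def)
    then have "(a - 2) * (real k - a) * y = a - 2 + 2 * y - y * (a * (a - 1))"
      by algebra
    also have "\<dots> = a - 2 + x - x * (a * (a - 1) / 2)"
      using \<open>x = 2 * y\<close> by simp
    finally show "x * real (card (h \<inter> S) choose 2) \<le> real (card (h \<inter> S)) - 2 + x"
      by (simp add: real_choose_two a_def)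
  qed
  finally show ?thesis .
qed

text \<open>The sum over all subsets factors as the product of the \<open>1 + w h\<close>, hence is
  at most \<open>exp W\<close> with \<open>W = sum w A\<close>. Removing the contribution
  \<open>1 + W\<close> of the subsets of size at most one leaves \<open>W^2\<close>, as
  \<open>exp W \<le> 1 + W + W^2\<close> on \<open>[0, 1]\<close>.\<close>

lemma sum_prod_subsets_card_ge_2:
  fixes w :: "'a \<Rightarrow> real"
  assumes A: "finite A" and w: "\<And>h. h \<in> A \<Longrightarrow> 0 \<le> w h" and W: "sum w A \<le> 1"
  shows "(\<Sum>F | F \<subseteq> A \<and> 2 \<le> card F. \<Prod>h\<in>F. w h) \<le> (sum w A)\<^sup>2"
proof -
  let ?P = "\<lambda>F. \<Prod>h\<in>F. w h"
  define B where "B = {F. F \<subseteq> A \<and> 2 \<le> card F}"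
  define C where "C = insert {} ((\<lambda>h. {h}) ` A)"
  have PowA: "Pow A = B \<union> C"
  proof
    show "Pow A \<subseteq> B \<union> C"
    proof
      fix F assume F: "F \<in> Pow A"
      show "F \<in> B \<union> C"
      proof (cases "2 \<le> card F")
        case False
        moreover have "finite F"
          using F A finite_subset by auto
        ultimately have "F = {} \<or> (\<exists>h. F = {h})"
          by (metis One_nat_def card_0_eq card_1_singletonE less_2_cases not_le)
        then show ?thesis
          using F by (auto simp: C_def)
      qed (use F in \<open>auto simp: B_def\<close>)
    qed
  qed (auto simp: B_def C_def)
  have disj: "B \<inter> C = {}"
    by (auto simp: B_def C_def)
  have fin: "finite B" "finite C"
    using A by (auto simp: B_def C_def)
  have "sum ?P C = 1 + sum w A"
    using A by (auto simp: C_def sum.insert_if sum.reindex)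
  then have "1 + sum w A + sum ?P B = sum ?P (Pow A)"
    using sum.union_disjoint[OF fin disj, of ?P] by (simp add: PowA)
  also have "\<dots> = (\<Prod>h\<in>A. w h + 1)"
    by (simp add: prod_add[OF A])
  also have "\<dots> \<le> (\<Prod>h\<in>A. exp (w h))"
    by (intro prod_mono) (use w in \<open>auto simp: add.commute\<close>)
  also have "\<dots> = exp (sum w A)"
    by (simp add: exp_sum[OF A])
  also have "\<dots> \<le> 1 + sum w A + (sum w A)\<^sup>2"
    by (rule exp_bound) (use w W in \<open>auto intro: sum_nonneg\<close>)
  finally show ?thesis
    by (simp add: B_def)
qed

text \<open>Such an \<open>h\<close> is determined by \<open>h - T\<close>, a set of
  \<open>s - card T\<close> vertices. The real exponent also covers \<open>card T > s\<close>, where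
  no \<open>h\<close> exists and the bound is merely nonnegative.\<close>

lemma card_nsets_inter_eq_le:
  assumes V: "finite V" "V \<noteq> {}" and "finite T"
  shows "real (card {h \<in> [V]\<^bsup>s\<^esup>. h \<inter> S = T}) \<le> real (card V) powr (real s - real (card T))"
proof (cases "{h \<in> [V]\<^bsup>s\<^esup>. h \<inter> S = T} = {}")
  case False
  let ?X = "{h \<in> [V]\<^bsup>s\<^esup>. h \<inter> S = T}" and ?r = "s - card T"
  from False obtain h where "h \<in> ?X" by blast
  then have le: "card T \<le> s"
    by (auto simp: nsets_def intro: card_mono)
  have "inj_on (\<lambda>h. h - T) ?X"
    by (rule inj_onI) blast
  moreover have "(\<lambda>h. h - T) ` ?X \<subseteq> [V]\<^bsup>?r\<^esup>"
    using \<open>finite T\<close> by (auto simp: nsets_def card_Diff_subset)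
  ultimately have "card ?X \<le> card V choose ?r"
    using card_inj_on_le[of "\<lambda>h. h - T" ?X "[V]\<^bsup>?r\<^esup>"] V(1) by (simp add: finite_imp_finite_nsets)
  also have "\<dots> \<le> card V ^ ?r"
    by (cases "?r \<le> card V") (simp_all add: binomial_le_pow binomial_eq_0)
  finally have "real (card ?X) \<le> real (card V) ^ ?r"
    by (metis of_nat_le_iff of_nat_power)
  also have "\<dots> = real (card V) powr (real s - real (card T))"
    using V le by (simp add: powr_realpow card_gt_0_iff flip: of_nat_diff)
  finally show ?thesis .
qed (use V in \<open>simp only: card.empty, simp\<close>)

text \<open>Hyperedges are grouped by their trace \<open>T\<close> on \<open>S\<close>. The number
  of hyperedges with trace \<open>T\<close> cancels the power of \<open>card V\<close> depending on
  \<open>card T\<close>, so each of the \<open>2 ^ card S\<close> traces contributes at most the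
  same amount.\<close>

lemma sum_edge_weights_le:
  fixes p x :: real
  assumes V: "finite V" "V \<noteq> {}" and S: "finite S" and p: "0 \<le> p"
  shows "(\<Sum>h\<in>[V]\<^bsup>s\<^esup>. p * real (card V) powr (real (card (h \<inter> S)) - 2 + x))
    \<le> 2 ^ card S * (p * real (card V) powr (real s - 2 + x))"
proof -
  let ?w = "\<lambda>a. p * real (card V) powr (real a - 2 + x)"
  let ?X = "\<lambda>T. {h \<in> [V]\<^bsup>s\<^esup>. h \<inter> S = T}"
  have "(\<Sum>h\<in>[V]\<^bsup>s\<^esup>. ?w (card (h \<inter> S))) = (\<Sum>T\<in>Pow S. \<Sum>h\<in>?X T. ?w (card (h \<inter> S)))"
    by (rule sum.group[symmetric]) (use V S in \<open>auto simp: finite_imp_finite_nsets\<close>)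
  also have "\<dots> = (\<Sum>T\<in>Pow S. \<Sum>h\<in>?X T. ?w (card T))"
    by (intro sum.cong) auto
  also have "\<dots> \<le> (\<Sum>T\<in>Pow S. p * real (card V) powr (real s - 2 + x))"
  proof (rule sum_mono)
    fix T assume "T \<in> Pow S"
    then have "finite T"
      using S finite_subset by auto
    then have "(\<Sum>h\<in>?X T. ?w (card T)) \<le> real (card V) powr (real s - real (card T)) * ?w (card T)"
      using card_nsets_inter_eq_le[OF V, of T s S] p by (simp add: mult_right_mono)
    also have "\<dots> = p * real (card V) powr (real s - 2 + x)"
      by (simp add: powr_add[symmetric] algebra_simps)
    finally show "(\<Sum>h\<in>?X T. ?w (card T)) \<le> p * real (card V) powr (real s - 2 + x)" .
  qed
  also have "\<dots> = 2 ^ card S * (p * real (card V) powr (real s - 2 + x))"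
    using S by (simp add: card_Pow)
  finally show ?thesis .
qed

text \<open>Each factor \<open>p\<close> is inflated to a weight \<open>w h\<close> depending on the
  size of \<open>h \<inter> S\<close>. By the exponent inequality, the product over an obstruction
  gains at least \<open>card V\<close> to the power \<open>card S - 2 + x\<close>, while the total
  weight stays at most \<open>2 ^ k * q\<close>; families of size at least two then cost its
  square.\<close>

lemma sum_obstructions_at_le:
  fixes p :: real and s :: nat
  assumes V: "finite V" "V \<noteq> {}" and S: "finite S" "card S \<le> k" and k: "k \<ge> 2" and p: "0 \<le> p"
  defines "x \<equiv> 2 / (real k + 1)"
  defines "q \<equiv> p * real (card V) powr (real s - 2 + x)"
  assumes q: "2 ^ k * q \<le> 1"
  shows "(\<Sum>F | F \<subseteq> [V]\<^bsup>s\<^esup> \<and> obstruction k S F. p ^ card F)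
    \<le> real (card V) powr (2 - x - real (card S)) * (2 ^ k * q)\<^sup>2"
proof -
  let ?A = "[V]\<^bsup>s\<^esup>" and ?v = "real (card V)"
  define w where "w = (\<lambda>h. p * ?v powr (real (card (h \<inter> S)) - 2 + x))"
  have A: "finite ?A"
    using V by (simp add: finite_imp_finite_nsets)
  have v: "?v \<ge> 1"
    using V by (simp add: Suc_le_eq card_gt_0_iff)
  have w0: "0 \<le> w h" for h
    using p by (simp add: w_def)
  have q0: "0 \<le> q"
    using p by (simp add: q_def)
  have "sum w ?A \<le> 2 ^ card S * q"
    using sum_edge_weights_le[OF V S(1) p] by (simp add: w_def q_def)
  also have "\<dots> \<le> 2 ^ k * q"
    using S(2) q0 by (intro mult_right_mono power_increasing) auto
  finally have W: "sum w ?A \<le> 2 ^ k * q" .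
  let ?B = "{F. F \<subseteq> ?A \<and> obstruction k S F}"
  have "p ^ card F \<le> ?v powr (2 - x - real (card S)) * prod w F" if "F \<in> ?B" for F
  proof -
    from that have F: "finite F" "obstruction k S F"
      using finite_subset[OF _ A] by auto
    have "prod w F = p ^ card F * ?v powr (\<Sum>h\<in>F. real (card (h \<inter> S)) - 2 + x)"
      using v by (simp add: w_def prod.distrib powr_sum)
    moreover have "?v powr (real (card S) - 2 + x) \<le> ?v powr (\<Sum>h\<in>F. real (card (h \<inter> S)) - 2 + x)"
      using obstruction_exponent[OF F k] v unfolding x_def by (intro powr_mono) auto
    ultimately have "p ^ card F * ?v powr (real (card S) - 2 + x) \<le> prod w F"
      using p by (simp add: mult_left_mono)
    then have "?v powr (2 - x - real (card S)) * (p ^ card F * ?v powr (real (card S) - 2 + x))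
        \<le> ?v powr (2 - x - real (card S)) * prod w F"
      by (rule mult_left_mono) simp
    moreover have "?v powr (2 - x - real (card S)) * (p ^ card F * ?v powr (real (card S) - 2 + x)) = p ^ card F"
      using v by (simp add: powr_add[symmetric] mult.left_commute)
    ultimately show ?thesis by simp
  qed
  then have "(\<Sum>F\<in>?B. p ^ card F) \<le> ?v powr (2 - x - real (card S)) * (\<Sum>F\<in>?B. prod w F)"
    unfolding sum_distrib_left by (rule sum_mono)
  also have "(\<Sum>F\<in>?B. prod w F) \<le> (\<Sum>F | F \<subseteq> ?A \<and> 2 \<le> card F. prod w F)"
    by (rule sum_mono2) (use A w0 in \<open>auto simp: obstruction_def intro: prod_nonneg\<close>)
  also have "\<dots> \<le> (sum w ?A)\<^sup>2"
    by (rule sum_prod_subsets_card_ge_2[OF A w0]) (use W q in linarith)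
  also have "\<dots> \<le> (2 ^ k * q)\<^sup>2"
    by (intro power_mono W sum_nonneg w0)
  finally show ?thesis
    by (simp add: mult_left_mono)
qed

lemma sum_UNION_le:
  fixes f :: "'b \<Rightarrow> real"
  assumes "finite I" "\<And>i. i \<in> I \<Longrightarrow> finite (A i)" "\<And>y. 0 \<le> f y"
  shows "sum f (\<Union>i\<in>I. A i) \<le> (\<Sum>i\<in>I. sum f (A i))"
  using assms(1,2)
proof (induction I)
  case (insert i I)
  have "sum f (A i \<union> (\<Union>i\<in>I. A i)) \<le> sum f (A i) + sum f (\<Union>i\<in>I. A i)"
    using insert assms(3) by (subst sum_Un) (auto intro: sum_nonneg)
  then show ?case
    using insert by force
qed simp

text \<open>The number of sets \<open>S\<close> of size \<open>j\<close> is at most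
  \<open>card V ^ j\<close>, which cancels the dependence on \<open>j\<close> in the bound for a
  fixed \<open>S\<close>. The sizes 2 and \<open>k\<close> therefore contribute equally, whence the
  factor 2.\<close>

lemma sum_obstructions_le:
  fixes p :: real and s :: nat
  assumes V: "finite V" "V \<noteq> {}" and k: "k \<ge> 2" and p: "0 \<le> p"
  defines "q \<equiv> p * real (card V) powr (real s - 2 + 2 / (real k + 1))"
  assumes q: "2 ^ k * q \<le> 1"
  shows "(\<Sum>F | F \<subseteq> [V]\<^bsup>s\<^esup> \<and> (\<exists>S\<subseteq>V. obstruction k S F). p ^ card F)
    \<le> 2 * 4 ^ k * q * (p * real (card V) ^ s)"
proof -
  define x where "x = 2 / (real k + 1)"
  let ?v = "real (card V)"
  let ?B = "\<lambda>S. {F. F \<subseteq> [V]\<^bsup>s\<^esup> \<and> obstruction k S F}"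
  have v: "?v > 0"
    using V by (simp add: card_gt_0_iff)
  have fin: "finite ([V]\<^bsup>j\<^esup>)" for j
    using V by (simp add: finite_imp_finite_nsets)
  have finB: "finite (?B S)" for S
    by (rule finite_subset[of _ "Pow ([V]\<^bsup>s\<^esup>)"]) (use fin in auto)
  have at: "(\<Sum>S\<in>[V]\<^bsup>j\<^esup>. \<Sum>F\<in>?B S. p ^ card F) \<le> ?v powr (2 - x) * (2 ^ k * q)\<^sup>2"
    if j: "j \<in> {2, k}" for j
  proof -
    have "(\<Sum>S\<in>[V]\<^bsup>j\<^esup>. \<Sum>F\<in>?B S. p ^ card F)
        \<le> (\<Sum>S\<in>[V]\<^bsup>j\<^esup>. ?v powr (2 - x - real j) * (2 ^ k * q)\<^sup>2)"
    proof (rule sum_mono)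
      fix S assume "S \<in> [V]\<^bsup>j\<^esup>"
      then have S: "finite S" "card S = j" "card S \<le> k"
        using j k by (auto simp: nsets_def)
      show "(\<Sum>F\<in>?B S. p ^ card F) \<le> ?v powr (2 - x - real j) * (2 ^ k * q)\<^sup>2"
        using sum_obstructions_at_le[OF V S(1,3) k p, of s] q S(2) by (simp add: q_def x_def)
    qed
    also have "\<dots> = real (card V choose j) * (?v powr (2 - x - real j) * (2 ^ k * q)\<^sup>2)"
      by simp
    also have "card V choose j \<le> card V ^ j"
      by (cases "j \<le> card V") (simp_all add: binomial_le_pow binomial_eq_0)
    then have "real (card V choose j) \<le> ?v powr real j"
      using v by (simp add: powr_realpow)
    then have "real (card V choose j) * (?v powr (2 - x - real j) * (2 ^ k * q)\<^sup>2)
        \<le> ?v powr real j * (?v powr (2 - x - real j) * (2 ^ k * q)\<^sup>2)"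
      by (rule mult_right_mono) simp
    also have "\<dots> = ?v powr (2 - x) * (2 ^ k * q)\<^sup>2"
      by (simp add: mult.assoc[symmetric] powr_add[symmetric])
    finally show ?thesis .
  qed
  have "{F. F \<subseteq> [V]\<^bsup>s\<^esup> \<and> (\<exists>S\<subseteq>V. obstruction k S F)} \<subseteq> (\<Union>S\<in>[V]\<^bsup>2\<^esup> \<union> [V]\<^bsup>k\<^esup>. ?B S)"
    using V(1) by (auto simp: obstruction_def nsets_def intro: finite_subset)
  then have "(\<Sum>F | F \<subseteq> [V]\<^bsup>s\<^esup> \<and> (\<exists>S\<subseteq>V. obstruction k S F). p ^ card F)
      \<le> (\<Sum>F\<in>(\<Union>S\<in>[V]\<^bsup>2\<^esup> \<union> [V]\<^bsup>k\<^esup>. ?B S). p ^ card F)"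
    using fin finB p by (intro sum_mono2) auto
  also have "\<dots> \<le> (\<Sum>S\<in>[V]\<^bsup>2\<^esup> \<union> [V]\<^bsup>k\<^esup>. \<Sum>F\<in>?B S. p ^ card F)"
    using fin finB p by (intro sum_UNION_le) auto
  also have "\<dots> \<le> (\<Sum>S\<in>[V]\<^bsup>2\<^esup>. \<Sum>F\<in>?B S. p ^ card F) + (\<Sum>S\<in>[V]\<^bsup>k\<^esup>. \<Sum>F\<in>?B S. p ^ card F)"
    using fin p by (subst sum_Un) (auto intro!: sum_nonneg)
  also have "\<dots> \<le> 2 * (?v powr (2 - x) * (2 ^ k * q)\<^sup>2)"
    using at[of 2] at[of k] by simp
  also have "\<dots> = 2 * 4 ^ k * q * (q * ?v powr (2 - x))"
    by (simp add: power2_eq_square power_mult_distrib[symmetric] mult_ac)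
  \<comment> \<open>One of the two factors \<open>q\<close> is spent on restoring the order of the
    expected number of hyperedges; the other remains as the gain.\<close>
  also have "q * ?v powr (2 - x) = p * ?v ^ s"
    using v by (simp add: q_def x_def powr_add[symmetric] powr_realpow)
  finally show ?thesis .
qed

section \<open>Tail bounds for independent Bernoulli hyperedges\<close>

lemma prob_bernoulli_subset:
  assumes A: "finite A" and F: "F \<subseteq> A" and p: "0 \<le> p" "p \<le> 1"
  shows "measure_pmf.prob (Pi_pmf A False (\<lambda>_. bernoulli_pmf p)) {X. \<forall>e\<in>F. X e} = p ^ card F"
proof -
  define B where "B = (\<lambda>e. if e \<in> F then {True} else UNIV)"
  have "{X. \<forall>e\<in>F. X e} = Pi A B"
    using F by (auto simp: B_def Pi_def)
  then have "measure_pmf.prob (Pi_pmf A False (\<lambda>_. bernoulli_pmf p)) {X. \<forall>e\<in>F. X e}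
      = (\<Prod>e\<in>A. measure_pmf.prob (bernoulli_pmf p) (B e))"
    by (simp only: measure_Pi_pmf_Pi[OF A])
  also have "\<dots> = (\<Prod>e\<in>A. if e \<in> F then p else 1)"
    by (intro prod.cong) (use p in \<open>auto simp: B_def measure_pmf_single\<close>)
  also have "\<dots> = p ^ card F"
    using A F by (simp add: prod.If_cases Int_absorb1)
  finally show ?thesis .
qed

text \<open>First moment method: linearity of expectation gives the mean of the count, and Markov's
  inequality the tail.\<close>

lemma prob_count_subsets_ge:
  assumes A: "finite A" and \<B>: "\<B> \<subseteq> Pow A" and p: "0 \<le> p" "p \<le> 1" and t: "0 < t"
  shows "measure_pmf.prob (Pi_pmf A False (\<lambda>_. bernoulli_pmf p))
      {X. t \<le> real (card {F \<in> \<B>. \<forall>e\<in>F. X e})} \<le> (\<Sum>F\<in>\<B>. p ^ card F) / t"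
proof -
  let ?M = "Pi_pmf A False (\<lambda>_. bernoulli_pmf p)"
  define Y where "Y = (\<lambda>X :: 'a \<Rightarrow> bool. \<Sum>F\<in>\<B>. indicator {X. \<forall>e\<in>F. X e} X :: real)"
  have fin: "finite \<B>"
    using \<B> A finite_subset by blast
  have Y: "Y X = real (card {F \<in> \<B>. \<forall>e\<in>F. X e})" for X
    using fin by (simp add: Y_def indicator_def sum.If_cases Int_def)
  have int: "integrable ?M (\<lambda>X. indicator {X. \<forall>e\<in>F. X e} X :: real)" for F
    by (intro measure_pmf.integrable_const_bound[where B = 1]) auto
  have "measure_pmf.prob ?M {X. t \<le> Y X} \<le> measure_pmf.expectation ?M Y / t"
    using integral_Markov_inequality_measure[of "measure_pmf ?M" Y UNIV t] t int
    by (simp add: Y_def sum_nonneg)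
  also have "measure_pmf.expectation ?M Y = (\<Sum>F\<in>\<B>. measure_pmf.prob ?M {X. \<forall>e\<in>F. X e})"
    unfolding Y_def using int by (subst Bochner_Integration.integral_sum) auto
  also have "\<dots> = (\<Sum>F\<in>\<B>. p ^ card F)"
    using \<B> by (intro sum.cong prob_bernoulli_subset A p) auto
  finally show ?thesis
    by (simp add: Y)
qed

text \<open>A Chernoff-type lower tail, from Markov's inequality applied to \<open>2\<close> to the
  minus count. With \<open>m\<close> the mean count, independence bounds its expectation by
  \<open>exp (- (m / 2))\<close>, and on the event it is at least \<open>exp (- (m / 4))\<close>
  because \<open>2 \<le> exp 1\<close>.\<close>

lemma prob_count_le_quarter_mean:
  assumes A: "finite A" and p: "0 \<le> p" "p \<le> 1"
  shows "measure_pmf.prob (Pi_pmf A False (\<lambda>_. bernoulli_pmf p))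
      {X. real (card {e \<in> A. X e}) \<le> real (card A) * p / 4} \<le> exp (- (real (card A) * p / 4))"
proof -
  let ?M = "Pi_pmf A False (\<lambda>_. bernoulli_pmf p)"
  define m where "m = real (card A) * p"
  define f where "f = (\<lambda>b. if b then 1 / 2 else 1 :: real)"
  define Y where "Y = (\<lambda>X. \<Prod>e\<in>A. f (X e))"
  have Y: "Y X = (1 / 2) ^ card {e \<in> A. X e}" for X
    using A by (simp add: Y_def f_def prod.If_cases Int_def)
  have Y0: "0 \<le> Y X" for X
    by (simp add: Y)
  have sub: "{X. real (card {e \<in> A. X e}) \<le> m / 4} \<subseteq> {X. exp (- (m / 4)) \<le> Y X}"
  proof clarify
    fix X assume le: "real (card {e \<in> A. X e}) \<le> m / 4"
    have "exp (- (m / 4)) \<le> exp (- real (card {e \<in> A. X e}))"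
      using le by simp
    also have "\<dots> = exp (- 1) ^ card {e \<in> A. X e}"
      by (simp flip: exp_of_nat_mult)
    also have "\<dots> \<le> (1 / 2) ^ card {e \<in> A. X e}"
      using exp_ge_add_one_self[of "1 :: real"] by (intro power_mono) (auto simp: exp_minus field_simps)
    finally show "exp (- (m / 4)) \<le> Y X"
      by (simp add: Y)
  qed
  have "measure_pmf.prob ?M {X. real (card {e \<in> A. X e}) \<le> m / 4} \<le> measure_pmf.prob ?M {X. exp (- (m / 4)) \<le> Y X}"
    by (rule measure_pmf.finite_measure_mono[OF sub]) simp
  also have "\<dots> \<le> measure_pmf.expectation ?M Y / exp (- (m / 4))"
  proof -
    have "integrable ?M Y"
      by (intro measure_pmf.integrable_const_bound[where B = 1]) (auto simp: Y power_le_one)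
    then show ?thesis
      using integral_Markov_inequality_measure[of "measure_pmf ?M" Y UNIV "exp (- (m / 4))"] Y0
      by simp
  qed
  also have "measure_pmf.expectation ?M Y = (\<Prod>e\<in>A. measure_pmf.expectation (bernoulli_pmf p) f)"
    unfolding Y_def
    by (rule expectation_prod_Pi_pmf[OF A])
       (auto simp: f_def intro!: integrable_measure_pmf_finite)
  also have "measure_pmf.expectation (bernoulli_pmf p) f = 1 - p / 2"
    using p by (simp add: f_def field_simps)
  also have "(\<Prod>e\<in>A. 1 - p / 2) \<le> exp (- p / 2) ^ card A"
    using p exp_ge_add_one_self[of "- p / 2"] by (simp add: power_mono)
  also have "exp (- p / 2) ^ card A = exp (- (m / 2))"
    by (simp add: m_def flip: exp_of_nat_mult)
  also have "exp (- (m / 2)) / exp (- (m / 4)) = exp (- (m / 4))"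
    by (simp flip: exp_diff)
  finally show ?thesis
    by (simp add: m_def divide_right_mono)
qed

section \<open>Probability that the removal succeeds, and its limit\<close>

lemma random_hypergraph_removal_prob:
  fixes p :: real and s n k :: nat
  assumes k: "k \<ge> 3" and s: "s < ramsey_number k" and p: "0 \<le> p" "p \<le> 1" and n: "0 < n"
  defines "q \<equiv> p * real n powr (real s - 2 + 2 / (real k + 1))"
  defines "m \<equiv> real (n choose s) * p"
  assumes q: "0 < q" "2 ^ k * q \<le> 1" and m: "0 < m"
  shows "1 - exp (- (m / 4)) - 8 * 4 ^ k * sqrt q * (p * real n ^ s / m)
    \<le> measure_pmf.prob (random_hypergraph s n p)
           {H. \<exists>H0. subhypergraph H0 H \<and>
                real (card (edges H0)) \<ge> (1 - sqrt q) * real (card (edges H)) \<and>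
                not_arrows (primal_graph H0) k}"
proof -
  let ?V = "{..<n}"
  define A where "A = [?V]\<^bsup>s\<^esup>"
  define M where "M = Pi_pmf A False (\<lambda>_. bernoulli_pmf p)"
  define E where "E = (\<lambda>X. {e \<in> A. X e})"
  define \<B> where "\<B> = {F. F \<subseteq> A \<and> (\<exists>S\<subseteq>?V. obstruction k S F)}"
  define Y where "Y = (\<lambda>X. card {F \<in> \<B>. \<forall>e\<in>F. X e})"
  define good where "good = {H :: nat hypergraph. \<exists>H0. subhypergraph H0 H \<and>
                real (card (edges H0)) \<ge> (1 - sqrt q) * real (card (edges H)) \<and>
                not_arrows (primal_graph H0) k}"
  \<comment> \<open>Once more than \<open>m / 4\<close> hyperedges are present, fewer than
    \<open>t\<close> deletions lose at most a fraction \<open>sqrt q\<close> of them. Markov's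
    inequality at this threshold costs a multiple of \<open>q / sqrt q = sqrt q\<close>.\<close>
  define t where "t = sqrt q * (m / 4)"
  have A: "finite A" "card A = n choose s"
    by (simp_all add: A_def finite_imp_finite_nsets)
  have t: "0 < t"
    using q m by (simp add: t_def)
  have imp: "(?V, E X) \<in> good" if X: "m / 4 < real (card (E X))" "real (Y X) < t" for X
  proof -
    have eq: "{F. F \<subseteq> E X \<and> (\<exists>S\<subseteq>?V. obstruction k S F)} = {F \<in> \<B>. \<forall>e\<in>F. X e}"
      by (auto simp: \<B>_def E_def)
    have "E X \<subseteq> [?V]\<^bsup>s\<^esup>"
      by (auto simp: E_def A_def)
    from removal_not_arrows[OF k s finite_lessThan this] obtain H0 where
      H0: "subhypergraph H0 (?V, E X)" "not_arrows (primal_graph H0) k"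
        "card (E X) \<le> card (edges H0) + Y X"
      unfolding eq Y_def by blast
    have "t \<le> sqrt q * real (card (E X))"
      unfolding t_def using X(1) q(1) by (intro mult_left_mono) auto
    then have "real (Y X) \<le> sqrt q * real (card (E X))"
      using X(2) by linarith
    moreover have "real (card (E X)) \<le> real (card (edges H0)) + real (Y X)"
      using H0(3) by linarith
    ultimately have "(1 - sqrt q) * real (card (E X)) \<le> real (card (edges H0))"
      by (simp add: left_diff_distrib)
    then show ?thesis
      using H0 unfolding good_def by (intro CollectI exI[of _ H0]) simp
  qed
  have small: "measure_pmf.prob M {X. real (card (E X)) \<le> m / 4} \<le> exp (- (m / 4))"
    using prob_count_le_quarter_mean[OF A(1) p] by (simp add: M_def E_def m_def A(2))
  have "measure_pmf.prob M {X. t \<le> real (Y X)} \<le> (\<Sum>F\<in>\<B>. p ^ card F) / t"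
    unfolding M_def Y_def by (rule prob_count_subsets_ge[OF A(1) _ p t]) (auto simp: \<B>_def)
  also have "\<dots> \<le> 2 * 4 ^ k * q * (p * real n ^ s) / t"
    using sum_obstructions_le[of ?V k p s] n k p q(2) t
    by (intro divide_right_mono) (auto simp: \<B>_def A_def q_def lessThan_empty_iff)
  also have "\<dots> = 8 * 4 ^ k * (q / sqrt q) * (p * real n ^ s / m)"
    by (simp add: t_def)
  also have "q / sqrt q = sqrt q"
    using q(1) by (simp add: real_div_sqrt)
  finally have many: "measure_pmf.prob M {X. t \<le> real (Y X)} \<le> 8 * 4 ^ k * sqrt q * (p * real n ^ s / m)" .
  \<comment> \<open>Union bound: every outcome is good, has too few hyperedges, or has too many
    obstructions.\<close>
  have "1 = measure_pmf.prob M ({X. (?V, E X) \<in> good} \<union> ({X. real (card (E X)) \<le> m / 4} \<union> {X. t \<le> real (Y X)}))"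
  proof -
    have "{X. (?V, E X) \<in> good} \<union> ({X. real (card (E X)) \<le> m / 4} \<union> {X. t \<le> real (Y X)}) = UNIV"
      using imp by (auto simp: not_le[symmetric])
    then show ?thesis
      by simp
  qed
  also have "\<dots> \<le> measure_pmf.prob M {X. (?V, E X) \<in> good} +
      (measure_pmf.prob M {X. real (card (E X)) \<le> m / 4} + measure_pmf.prob M {X. t \<le> real (Y X)})"
    by (intro order_trans[OF measure_Un_le] add_left_mono measure_Un_le) auto
  finally have "1 - exp (- (m / 4)) - 8 * 4 ^ k * sqrt q * (p * real n ^ s / m)
      \<le> measure_pmf.prob M {X. (?V, E X) \<in> good}"
    using small many by linarith
  also have "\<dots> = measure_pmf.prob (random_hypergraph s n p) good"
    by (simp add: random_hypergraph_def M_def A_def E_def vimage_def)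
  finally show ?thesis
    by (simp add: good_def)
qed

theorem theorem3p2:
  fixes k s :: nat and p :: "nat \<Rightarrow> real"
  assumes "k \<ge> 3"
    and "s = ramsey_number k - 1"
    and "\<And>n. 0 \<le> p n \<and> p n \<le> 1"
    and "filterlim (\<lambda>n. p n * real n ^ s) at_top sequentially"
    and "(\<lambda>n. p n * real n powr
           (real s - 2 + 1 / max_2_density (complete_graph_on {..<k}))) \<longlonglongrightarrow> 0"
  shows "\<exists>\<epsilon> :: nat \<Rightarrow> real. \<epsilon> \<longlonglongrightarrow> 0 \<and>
    (\<lambda>n. measure_pmf.prob (random_hypergraph s n (p n))
           {H. \<exists>H0. subhypergraph H0 H \<and>
                real (card (edges H0)) \<ge> (1 - \<epsilon> n) * real (card (edges H)) \<and>
                not_arrows (primal_graph H0) k}) \<longlonglongrightarrow> 1"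
proof -
  define q where "q = (\<lambda>n. p n * real n powr (real s - 2 + 2 / (real k + 1)))"
  define m where "m = (\<lambda>n. real (n choose s) * p n)"
  \<comment> \<open>The witness for \<open>\<epsilon>\<close> is \<open>sqrt (q n)\<close>, which
    makes both the deleted fraction and the bound on the failure probability vanish.\<close>
  let ?P = "\<lambda>n. measure_pmf.prob (random_hypergraph s n (p n))
           {H. \<exists>H0. subhypergraph H0 H \<and>
                real (card (edges H0)) \<ge> (1 - sqrt (q n)) * real (card (edges H)) \<and>
                not_arrows (primal_graph H0) k}"
  have s: "s < ramsey_number k" "0 < s"
    using assms(1,2) ramsey_number_ge[of k] by auto
  have q: "q \<longlonglongrightarrow> 0"
    using assms(5) by (simp add: q_def max_2_density_complete[OF assms(1)])
  then have sq: "(\<lambda>n. sqrt (q n)) \<longlonglongrightarrow> 0"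
    using tendsto_real_sqrt[of q 0] by simp
  \<comment> \<open>By \<open>n choose s \<ge> (n / s) ^ s\<close>, the mean \<open>m n\<close> has
    at least the order of \<open>p n * n ^ s\<close>. This transfers divergence to \<open>m\<close>
    and bounds the ratio in the probability estimate by \<open>s ^ s\<close>.\<close>
  have m_ge: "p n * real n ^ s \<le> real s ^ s * m n" if "s \<le> n" for n
  proof -
    have "real n ^ s / real s ^ s \<le> real (n choose s)"
      using binomial_ge_n_over_k_pow_k[OF that, where 'a = real] by (simp add: power_divide)
    then have "real n ^ s \<le> real s ^ s * real (n choose s)"
      using s(2) by (simp add: field_simps)
    then have "p n * real n ^ s \<le> p n * (real s ^ s * real (n choose s))"
      using assms(3) by (intro mult_left_mono) auto
    then show ?thesis
      by (simp add: m_def mult_ac)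
  qed
  have "filterlim (\<lambda>n. real s ^ s * m n) at_top sequentially"
    by (rule filterlim_at_top_mono[OF assms(4)])
       (use m_ge in \<open>auto intro: eventually_sequentiallyI[of s]\<close>)
  then have m: "filterlim m at_top sequentially"
    using s(2) by (subst (asm) filterlim_tendsto_pos_mult_at_top_iff[OF tendsto_const]) auto
  have lower: "eventually (\<lambda>n. 1 - exp (- (m n / 4)) - 8 * 4 ^ k * real s ^ s * sqrt (q n) \<le> ?P n) sequentially"
  proof -
    have "eventually (\<lambda>n. 0 < p n * real n ^ s) sequentially" "eventually (\<lambda>n. 0 < m n) sequentially"
      using assms(4) m by (auto simp: filterlim_at_top_dense)
    moreover have "eventually (\<lambda>n. q n < 1 / 2 ^ k) sequentially"
      using q by (rule order_tendstoD) simp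
    ultimately show ?thesis
      using eventually_ge_at_top[of s]
    proof eventually_elim
      case (elim n)
      \<comment> \<open>Strict positivity of \<open>p n\<close> comes from that of
        \<open>p n * n ^ s\<close>; it makes \<open>q n\<close> positive, as the finite estimate
        requires.\<close>
      have n: "0 < n" and pn: "0 < p n"
        using elim s(2) assms(3)[of n] by (auto simp: zero_less_mult_iff)
      have "0 < q n"
        using n pn by (simp add: q_def)
      moreover have "2 ^ k * q n \<le> 1"
        using elim(3) by (simp add: field_simps)
      ultimately have "1 - exp (- (m n / 4)) - 8 * 4 ^ k * sqrt (q n) * (p n * real n ^ s / m n) \<le> ?P n"
        using random_hypergraph_removal_prob[OF assms(1) s(1) _ _ n, of "p n"] assms(3) elim(2)
        by (simp add: q_def m_def)
      moreover have "p n * real n ^ s / m n \<le> real s ^ s"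
        using m_ge[OF elim(4)] elim(2) by (simp add: field_simps)
      then have "8 * 4 ^ k * sqrt (q n) * (p n * real n ^ s / m n) \<le> 8 * 4 ^ k * sqrt (q n) * real s ^ s"
        using \<open>0 < q n\<close> by (intro mult_left_mono) auto
      ultimately show ?case
        by (simp add: mult_ac)
    qed
  qed
  have "filterlim (\<lambda>n. 1 / 4 * m n) at_top sequentially"
    by (rule filterlim_tendsto_pos_mult_at_top[OF tendsto_const _ m]) simp
  then have "(\<lambda>n. exp (- (m n / 4))) \<longlonglongrightarrow> 0"
    by (intro filterlim_compose[OF exp_at_bot]) (simp add: filterlim_uminus_at_bot)
  then have "(\<lambda>n. 1 - exp (- (m n / 4)) - 8 * 4 ^ k * real s ^ s * sqrt (q n))
      \<longlonglongrightarrow> 1 - 0 - 8 * 4 ^ k * real s ^ s * 0"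
    using sq by (intro tendsto_intros)
  then have lim: "(\<lambda>n. 1 - exp (- (m n / 4)) - 8 * 4 ^ k * real s ^ s * sqrt (q n)) \<longlonglongrightarrow> 1"
    by simp
  have "?P \<longlonglongrightarrow> 1"
    by (rule tendsto_sandwich[OF lower _ lim tendsto_const]) simp
  with sq show ?thesis
    by blast
qed

end
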